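(* Suppose each $f_i:\mathbb{R}^d\to\mathbb{R}$ ($i\in[n]$) is $\mu$-strongly convex and $L$-smooth, let $0<\alpha\le \frac{2}{\mu+L}$ and $\theta\in(0,1)$. Let $(x^t)_{t\ge 0}$ be generated by Prox-DFinito with step-size $\alpha$, damping parameter $\theta$ and initialization $\boldsymbol{z}^0\in\mathbb{R}^{nd}$. (i) If cyclic sampling with a fixed order $\pi$ is used, then for every $k=0,1,2,\dots$ $$\|x^{kn}-x^\star\|^2\le\Big(1-\frac{2\theta\alpha\mu L}{\mu+L}\Big)^k\,\frac{\log(n)+1}{n}\|\boldsymbol{z}^0-\boldsymbol{z}^\star\|_\pi^2 .$$ (ii) If random reshuffling is used, then for every $k=0,1,2,\dots$ $$\mathbb{E}\,\|x^{kn}-x^\star\|^2\le\Big(1-\frac{2\theta\alpha\mu L}{\mu+L}\Big)^k\,\frac{1}{n}\|\boldsymbol{z}^0-\boldsymbol{z}^\star\|^2 .$$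
   Context: Problem: $\min_{x\in\mathbb{R}^d}F(x)+r(x)$ with $F=\frac1n\sum_{i=1}^n f_i$, each $f_i$ differentiable, and $r:\mathbb{R}^d\to\mathbb{R}\cup\{+\infty\}$ convex, closed and proper (not necessarily differentiable). $[n]=\{1,\dots,n\}$; $L\ge\mu>0$, and $L$-smooth means the gradient is $L$-Lipschitz. $\mathrm{prox}_{\alpha r}(x)=\arg\min_{y}\{\alpha r(y)+\frac12\|y-x\|^2\}$. $\|\cdot\|$ is the Euclidean norm. $x^\star$ is the minimizer of $F+r$, and $\boldsymbol{z}^\star=\mathrm{col}\{z_1^\star,\dots,z_n^\star\}\in\mathbb{R}^{nd}$ (stacked vector) with $z_i^\star=x^\star-\alpha\nabla f_i(x^\star)$. Order-specific norm: for a permutation $\pi$ of $[n]$ and $\boldsymbol{z}=\mathrm{col}\{z_1,\dots,z_n\}\in\mathbb{R}^{nd}$, $\|\boldsymbol{z}\|_\pi^2=\sum_{i=1}^n\frac{i}{n}\|z_{\pi(i)}\|^2$. Prox-DFinito: given (deterministic) $\boldsymbol{z}^0=\mathrm{col}\{z_1^0,\dots,z_n^0\}$, set $\bar z^0=\frac1n\sum_i z_i^0$. For each epoch $k=0,1,2,\dots$: for $t=kn+1,\dots,(k+1)n$, set $x^{t-1}=\mathrm{prox}_{\alpha r}(\bar z^{t-1})$, pick an index $i_t$, set $z_{i_t}^t=x^{t-1}-\alpha\nabla f_{i_t}(x^{t-1})$, $z_i^t=z_i^{t-1}$ for $i\ne i_t$, and $\bar z^t=\bar z^{t-1}+(z_{i_t}^t-z_{i_t}^{t-1})/n$.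 At the end of the epoch apply the damping step: overwrite $z_i^{(k+1)n}\leftarrow(1-\theta)z_i^{kn}+\theta z_i^{(k+1)n}$ for all $i$ and $\bar z^{(k+1)n}\leftarrow(1-\theta)\bar z^{kn}+\theta\bar z^{(k+1)n}$. Thus $x^{kn}=\mathrm{prox}_{\alpha r}(\bar z^{kn})$ with the damped $\bar z^{kn}$. Cyclic sampling with order $\pi$: $i_{kn+j}=\pi(j)$ for all epochs $k$ and $j\in[n]$. Random reshuffling: at the start of each epoch $k$ a fresh (independent) uniformly random permutation $\tau_k$ of $[n]$ is drawn, and $i_{kn+j}=\tau_k(j)$ for $j\in[n]$; expectation is over all the permutations. *)

theory Defs
  imports "HOL-Probability.Probability"
begin

definition grad :: "('a::real_inner \<Rightarrow> real) \<Rightarrow> 'a \<Rightarrow> 'a" where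
  "grad f x = (THE g. GDERIV f x :> g)"

definition smooth_fun :: "real \<Rightarrow> ('a::real_inner \<Rightarrow> real) \<Rightarrow> bool" where
  "smooth_fun L f \<longleftrightarrow> (\<forall>x. f differentiable (at x)) \<and> L-lipschitz_on UNIV (grad f)"

definition strongly_convex :: "real \<Rightarrow> ('a::real_inner \<Rightarrow> real) \<Rightarrow> bool" where
  "strongly_convex \<mu> f \<longleftrightarrow>
    (\<forall>x y. \<forall>u\<ge>0. \<forall>v\<ge>0. u + v = 1 \<longrightarrow>
      f (u *\<^sub>R x + v *\<^sub>R y) \<le> u * f x + v * f y - \<mu> / 2 * u * v * (norm (x - y))\<^sup>2)"

definition ereal_proper :: "('a \<Rightarrow> ereal) \<Rightarrow> bool" where
  "ereal_proper r \<longleftrightarrow> (\<forall>x. r x \<noteq> -\<infinity>) \<and> (\<exists>x. r x \<noteq> \<infinity>)"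

(* Used for proper functions only, so the right-hand side never has the form \<infinity> - \<infinity>;
   for u = 0 the convention 0 * \<infinity> = 0 of ereal makes the inequality trivial. *)
definition ereal_convex :: "('a::real_vector \<Rightarrow> ereal) \<Rightarrow> bool" where
  "ereal_convex r \<longleftrightarrow>
    (\<forall>x y. \<forall>u\<ge>0. \<forall>v\<ge>0. u + v = 1 \<longrightarrow>
      r (u *\<^sub>R x + v *\<^sub>R y) \<le> ereal u * r x + ereal v * r y)"

definition ereal_closed :: "('a::topological_space \<Rightarrow> ereal) \<Rightarrow> bool" where
  "ereal_closed r \<longleftrightarrow> closed {(x, t). r x \<le> ereal t}"

definition prox :: "real \<Rightarrow> ('a::real_normed_vector \<Rightarrow> ereal) \<Rightarrow> 'a \<Rightarrow> 'a" where
  "prox \<alpha> r x = (ARG_MIN (\<lambda>y. ereal \<alpha> * r y + ereal (1 / 2 * (norm (y - x))\<^sup>2)) y. True)"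

(* Stacked vectors col{z_1, ..., z_n} are functions on nat; only the arguments 1, ..., n matter. *)
definition stacked_norm :: "nat \<Rightarrow> (nat \<Rightarrow> 'a::real_normed_vector) \<Rightarrow> real" where
  "stacked_norm n z = L2_set (\<lambda>i. norm (z i)) {1..n}"

definition order_norm :: "nat \<Rightarrow> (nat \<Rightarrow> nat) \<Rightarrow> (nat \<Rightarrow> 'a::real_normed_vector) \<Rightarrow> real" where
  "order_norm n \<pi> z = sqrt (\<Sum>i=1..n. real i / real n * (norm (z (\<pi> i)))\<^sup>2)"

(* The algorithm state is the pair of the table z and the separately maintained average zbar. *)
definition dfinito_step ::
  "nat \<Rightarrow> real \<Rightarrow> (nat \<Rightarrow> 'a::real_inner \<Rightarrow> real) \<Rightarrow> ('a \<Rightarrow> ereal) \<Rightarrow> nat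
    \<Rightarrow> (nat \<Rightarrow> 'a) \<times> 'a \<Rightarrow> (nat \<Rightarrow> 'a) \<times> 'a" where
  "dfinito_step n \<alpha> f r i s =
    (let z = fst s; zbar = snd s;
         x = prox \<alpha> r zbar;
         w = x - \<alpha> *\<^sub>R grad (f i) x
     in (z(i := w), zbar + (w - z i) /\<^sub>R real n))"

definition dfinito_damp ::
  "real \<Rightarrow> (nat \<Rightarrow> 'a::real_vector) \<times> 'a \<Rightarrow> (nat \<Rightarrow> 'a) \<times> 'a \<Rightarrow> (nat \<Rightarrow> 'a) \<times> 'a" where
  "dfinito_damp \<theta> s s' =
    ((\<lambda>i. (1 - \<theta>) *\<^sub>R fst s i + \<theta> *\<^sub>R fst s' i), (1 - \<theta>) *\<^sub>R snd s + \<theta> *\<^sub>R snd s')"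

(* State after t updates, with idx t the index selected in update t >= 1. When t is a multiple
   of n, this is the state after the damping, which combines it with the state n updates ago,
   i.e. the (already damped) state at the start of the epoch. *)
function dfinito_state ::
  "nat \<Rightarrow> real \<Rightarrow> real \<Rightarrow> (nat \<Rightarrow> 'a::real_inner \<Rightarrow> real) \<Rightarrow> ('a \<Rightarrow> ereal) \<Rightarrow> (nat \<Rightarrow> 'a)
    \<Rightarrow> (nat \<Rightarrow> nat) \<Rightarrow> nat \<Rightarrow> (nat \<Rightarrow> 'a) \<times> 'a" where
  "dfinito_state n \<alpha> \<theta> f r z0 idx 0 = (z0, (\<Sum>i=1..n. z0 i) /\<^sub>R real n)"
| "dfinito_state n \<alpha> \<theta> f r z0 idx (Suc t) =
    (let s = dfinito_step n \<alpha> f r (idx (Suc t)) (dfinito_state n \<alpha> \<theta> f r z0 idx t)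
     in if n dvd Suc t then dfinito_damp \<theta> (dfinito_state n \<alpha> \<theta> f r z0 idx (Suc t - n)) s else s)"
  by pat_completeness auto
termination
  by (relation "Wellfounded.measure (\<lambda>(n, \<alpha>, \<theta>, f, r, z0, idx, t). t)") (auto intro!: diff_less dvd_pos_nat[of "Suc _"])

definition dfinito_iterate ::
  "nat \<Rightarrow> real \<Rightarrow> real \<Rightarrow> (nat \<Rightarrow> 'a::real_inner \<Rightarrow> real) \<Rightarrow> ('a \<Rightarrow> ereal) \<Rightarrow> (nat \<Rightarrow> 'a)
    \<Rightarrow> (nat \<Rightarrow> nat) \<Rightarrow> nat \<Rightarrow> 'a" where
  "dfinito_iterate n \<alpha> \<theta> f r z0 idx t = prox \<alpha> r (snd (dfinito_state n \<alpha> \<theta> f r z0 idx t))"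

(* Index sequence that follows the order \<sigma> k during epoch k; see epoch_index_eq. *)
definition epoch_index :: "nat \<Rightarrow> (nat \<Rightarrow> nat \<Rightarrow> nat) \<Rightarrow> nat \<Rightarrow> nat" where
  "epoch_index n \<sigma> t = \<sigma> ((t - 1) div n) ((t - 1) mod n + 1)"

lemma epoch_index_eq:
  assumes "j \<in> {1..n}"
  shows "epoch_index n \<sigma> (k * n + j) = \<sigma> k j"
proof -
  obtain i where i: "j = Suc i" "i < n"
    using assms by (cases j) auto
  then show ?thesis
    by (simp add: epoch_index_def)
qed

(* \<tau> k is the permutation drawn at the start of epoch k. *)
definition random_reshuffling :: "'w measure \<Rightarrow> nat \<Rightarrow> (nat \<Rightarrow> 'w \<Rightarrow> nat \<Rightarrow> nat) \<Rightarrow> bool" where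
  "random_reshuffling M n \<tau> \<longleftrightarrow>
    prob_space M \<and>
    prob_space.indep_vars M (\<lambda>_. count_space {p. p permutes {1..n}}) \<tau> UNIV \<and>
    (\<forall>k. distr M (count_space {p. p permutes {1..n}}) (\<tau> k) =
         uniform_count_measure {p. p permutes {1..n}})"

end

theory Submission
  imports Defs
begin

text \<open>
  Cocoercivity of the gradients makes \<open>x - \<alpha> grad f\<^sub>i x\<close> a contraction with squared factor
  \<open>\<rho> = 1 - 2\<alpha>\<mu>L/(\<mu> + L)\<close>, and the proximal map is nonexpansive; so in every step the visited block
  gets a squared error of at most \<open>\<rho>\<close> times the current mean of the squared block errors.
  For a fixed order, summing this over an epoch counts the old error of the \<open>i\<close>-th visited block \<open>i\<close>
  times and its new error \<open>n - i\<close> times, which is exactly a contraction by \<open>\<rho>\<close> of the sum weighted by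
  \<open>i/n\<close>; the weights are traded for the logarithm by Cauchy--Schwarz and the harmonic sum.
  For a uniformly random order all blocks have the same expected old error, so the expected mean
  itself contracts by \<open>\<rho>\<close>. Damping turns \<open>\<rho>\<close> into \<open>1 - \<theta> + \<theta>\<rho>\<close> by convexity of the squared norm.
\<close>

subsection \<open>Smooth strongly convex functions\<close>

text \<open>The vector of values of the derivative on the basis represents it, and such a
  representation is unique; so the description operator in \<open>grad\<close> selects it.\<close>

lemma GDERIV_grad:
  fixes f :: "'a::euclidean_space \<Rightarrow> real"
  assumes "f differentiable (at x)"
  shows "GDERIV f x :> grad f x"
proof -
  obtain f' where f': "(f has_derivative f') (at x)"
    using assms by (auto simp: differentiable_def)
  define g where "g = (\<Sum>b\<in>Basis. f' b *\<^sub>R b)"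
  have "f' h = inner h g" for h
  proof -
    interpret f': bounded_linear f' using f' by (rule has_derivative_bounded_linear)
    have "f' h = f' (\<Sum>b\<in>Basis. inner h b *\<^sub>R b)"
      by (simp add: euclidean_representation)
    also have "\<dots> = inner h g"
      by (simp add: f'.sum f'.scaleR g_def inner_sum_right mult.commute)
    finally show ?thesis .
  qed
  then have "f' = (\<lambda>h. inner h g)" by blast
  with f' have g: "GDERIV f x :> g" by (simp add: gderiv_def)
  have "g' = g" if "GDERIV f x :> g'" for g'
  proof -
    have "(\<lambda>h. inner h g') = (\<lambda>h. inner h g)"
      using that g unfolding gderiv_def by (rule has_derivative_unique)
    then have "inner (g' - g) g' = inner (g' - g) g" by metis
    then have "inner (g' - g) (g' - g) = 0" by (simp add: inner_diff_right)
    then show ?thesis by simp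
  qed
  with g have "(THE g. GDERIV f x :> g) = g" by blast
  with g show ?thesis by (simp add: grad_def)
qed

lemma GDERIV_line:
  assumes "GDERIV f (x + t *\<^sub>R d) :> g"
  shows "((\<lambda>t. f (x + t *\<^sub>R d)) has_real_derivative inner d g) (at t)"
proof -
  have "((\<lambda>t. x + t *\<^sub>R d) has_derivative (\<lambda>h. h *\<^sub>R d)) (at t)"
    by (auto intro!: derivative_eq_intros)
  from has_derivative_compose[OF this assms[unfolded gderiv_def]]
  show ?thesis by (simp add: has_field_derivative_def mult_commute_abs)
qed

text \<open>The limit is one-sided because the secant inequalities from convexity are available only
  for \<open>t\<close> between 0 and 1.\<close>

lemma GDERIV_line_quotient:
  assumes "GDERIV f x :> g"
  shows "((\<lambda>t. (f (x + t *\<^sub>R d) - f x) / t) \<longlongrightarrow> inner d g) (at_right 0)"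
proof -
  have "((\<lambda>t. f (x + t *\<^sub>R d)) has_real_derivative inner d g) (at 0)"
    using GDERIV_line[of f x 0 d g] assms by simp
  then show ?thesis
    by (auto simp: has_field_derivative_iff intro: filterlim_at_within_not_equal tendsto_within_subset)
qed

text \<open>Divide the strong convexity inequality at \<open>x + t *\<^sub>R (y - x)\<close> by
  \<open>t\<close> and let \<open>t\<close> tend to 0.\<close>

lemma strongly_convex_lower:
  assumes "strongly_convex \<mu> f" "GDERIV f x :> g"
  shows "f y \<ge> f x + inner (y - x) g + \<mu> / 2 * (norm (y - x))\<^sup>2"
proof -
  have "(f (x + t *\<^sub>R (y - x)) - f x) / t \<le> f y - f x - \<mu> / 2 * (1 - t) * (norm (y - x))\<^sup>2"
    if "t \<in> {0<..<1}" for t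
  proof -
    have "f ((1 - t) *\<^sub>R x + t *\<^sub>R y) \<le> (1 - t) * f x + t * f y - \<mu> / 2 * (1 - t) * t * (norm (x - y))\<^sup>2"
      using assms(1) that unfolding strongly_convex_def by force
    moreover have "(1 - t) *\<^sub>R x + t *\<^sub>R y = x + t *\<^sub>R (y - x)"
      by (simp add: algebra_simps)
    ultimately show ?thesis
      using that by (simp add: divide_simps norm_minus_commute algebra_simps)
  qed
  then have "eventually (\<lambda>t. (f (x + t *\<^sub>R (y - x)) - f x) / t
      \<le> f y - f x - \<mu> / 2 * (1 - t) * (norm (y - x))\<^sup>2) (at_right 0)"
    by (auto simp: eventually_at_right_field intro!: exI[of _ 1])
  moreover have "((\<lambda>t. f y - f x - \<mu> / 2 * (1 - t) * (norm (y - x))\<^sup>2) \<longlongrightarrow>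
      f y - f x - \<mu> / 2 * (1 - 0) * (norm (y - x))\<^sup>2) (at_right 0)"
    by (intro tendsto_intros)
  ultimately have "inner (y - x) g \<le> f y - f x - \<mu> / 2 * (1 - 0) * (norm (y - x))\<^sup>2"
    by (intro tendsto_le[OF _ _ GDERIV_line_quotient[OF assms(2)]]) auto
  then show ?thesis by simp
qed

lemma smooth_fun_upper:
  fixes f :: "'a::euclidean_space \<Rightarrow> real"
  assumes "smooth_fun L f"
  shows "f y \<le> f x + inner (y - x) (grad f x) + L / 2 * (norm (y - x))\<^sup>2"
proof -
  define d where "d = y - x"
  \<comment> \<open>Up to a constant, the excess of \<open>f\<close> over its quadratic majorant
    along the segment; Cauchy-Schwarz and the Lipschitz bound make its derivative
    nonpositive.\<close>
  define \<phi> where "\<phi> t = f (x + t *\<^sub>R d) - t * inner d (grad f x) - L / 2 * t\<^sup>2 * (norm d)\<^sup>2" for t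
  have "\<phi> 1 \<le> \<phi> 0"
  proof (rule DERIV_nonpos_imp_nonincreasing[of 0 1])
    fix t :: real
    assume t: "0 \<le> t" "t \<le> 1"
    have D: "GDERIV f (x + t *\<^sub>R d) :> grad f (x + t *\<^sub>R d)"
      using assms by (intro GDERIV_grad) (auto simp: smooth_fun_def)
    have "(\<phi> has_real_derivative inner d (grad f (x + t *\<^sub>R d)) - inner d (grad f x) - L * t * (norm d)\<^sup>2) (at t)"
      unfolding \<phi>_def by (rule derivative_eq_intros GDERIV_line[OF D] refl | simp)+
    moreover have "inner d (grad f (x + t *\<^sub>R d)) - inner d (grad f x) \<le> L * t * (norm d)\<^sup>2"
    proof -
      have "inner d (grad f (x + t *\<^sub>R d) - grad f x) \<le> norm d * norm (grad f (x + t *\<^sub>R d) - grad f x)"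
        by (rule norm_cauchy_schwarz)
      also have "\<dots> \<le> norm d * (L * norm (t *\<^sub>R d))"
        using lipschitz_onD[of L UNIV "grad f" "x + t *\<^sub>R d" x] assms
        by (intro mult_left_mono) (auto simp: smooth_fun_def dist_norm)
      finally show ?thesis
        using t by (simp add: inner_diff_right power2_eq_square mult_ac)
    qed
    ultimately show "\<exists>D. (\<phi> has_real_derivative D) (at t) \<and> D \<le> 0" by fastforce
  qed simp
  then show ?thesis by (simp add: \<phi>_def d_def)
qed

text \<open>Bregman distance bound for \<open>f - (\<mu>/2) norm\<^sup>2\<close>, which is convex and \<open>L - \<mu>\<close> smooth: compare its
  tangent at \<open>x\<close> with its quadratic majorant at \<open>y\<close> in the point \<open>y - \<delta> / (L - \<mu>)\<close>.\<close>
lemma bregman_lower_bound: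
  fixes f :: "'a::euclidean_space \<Rightarrow> real"
  assumes f: "strongly_convex \<mu> f" "smooth_fun L f" and "\<mu> < L"
  defines "h \<equiv> \<lambda>x. f x - \<mu> / 2 * (norm x)\<^sup>2"
  defines "h' \<equiv> \<lambda>x. grad f x - \<mu> *\<^sub>R x"
  shows "h y \<ge> h x + inner (y - x) (h' x) + (norm (h' y - h' x))\<^sup>2 / (2 * (L - \<mu>))"
proof -
  define s where "s = 1 / (L - \<mu>)"
  have s: "(L - \<mu>) * s = 1" using assms(3) by (simp add: s_def)
  define \<delta> where "\<delta> = h' y - h' x"
  define z where "z = y - s *\<^sub>R \<delta>"
  have D: "GDERIV f x :> grad f x"
    using f(2) by (intro GDERIV_grad) (auto simp: smooth_fun_def)
  \<comment> \<open>Expanding the subtracted square around \<open>w\<close> turns the lower bound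
    for \<open>f\<close> into a tangent inequality for \<open>h\<close> and reduces the curvature of
    the upper bound from \<open>L\<close> to \<open>L - \<mu>\<close>.\<close>
  have sq: "\<mu> / 2 * (norm z)\<^sup>2 = \<mu> / 2 * (norm w)\<^sup>2 + inner (z - w) (\<mu> *\<^sub>R w) + \<mu> / 2 * (norm (z - w))\<^sup>2" for w
    by (simp add: power2_norm_eq_inner inner_diff_left inner_diff_right inner_commute field_simps)
  have 1: "h z \<ge> h x + inner (z - x) (h' x)"
    using strongly_convex_lower[OF f(1) D, of z] unfolding h_def h'_def sq[of x] inner_diff_right
    by simp
  have 2: "h z \<le> h y + inner (z - y) (h' y) + (L - \<mu>) / 2 * (norm (z - y))\<^sup>2"
    using smooth_fun_upper[OF f(2), of z y]
    unfolding h_def h'_def sq[of y] inner_diff_right left_diff_distrib diff_divide_distrib by simp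
  have "(L - \<mu>) / 2 * (norm (z - y))\<^sup>2 = ((L - \<mu>) * s) * s / 2 * (norm \<delta>)\<^sup>2"
    by (simp add: z_def power2_eq_square)
  then have 3: "(L - \<mu>) / 2 * (norm (z - y))\<^sup>2 = s / 2 * (norm \<delta>)\<^sup>2"
    by (simp add: s)
  have "inner (z - y) (h' y) - inner (z - x) (h' x) = inner (z - y) \<delta> - inner (y - x) (h' x)"
    by (simp add: \<delta>_def inner_diff_left inner_diff_right)
  also have "inner (z - y) \<delta> = - s * (norm \<delta>)\<^sup>2"
    by (simp add: z_def power2_norm_eq_inner)
  finally have "h y \<ge> h x + inner (y - x) (h' x) + s / 2 * (norm \<delta>)\<^sup>2"
    using 1 2 3 by simp
  then show ?thesis by (simp add: s_def \<delta>_def algebra_simps)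
qed

text \<open>Adding the Bregman bound to its copy with \<open>x\<close> and \<open>y\<close>
  exchanged cancels the function values. That bound divides by \<open>L - \<mu>\<close>; for
  \<open>\<mu> = L\<close>, strong monotonicity and the Lipschitz bound give the claim
  directly.\<close>

lemma gradient_cocoercive:
  fixes f :: "'a::euclidean_space \<Rightarrow> real"
  assumes f: "strongly_convex \<mu> f" "smooth_fun L f" and "0 \<le> \<mu>" "\<mu> \<le> L"
  defines "g \<equiv> \<lambda>x y. grad f x - grad f y"
  shows "(\<mu> + L) * inner (x - y) (g x y) \<ge> \<mu> * L * (norm (x - y))\<^sup>2 + (norm (g x y))\<^sup>2"
proof (cases "\<mu> = L")
  case False
  define h' where "h' x = grad f x - \<mu> *\<^sub>R x" for x
  have "\<mu> < L" using False assms by simp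
  note B = bregman_lower_bound[OF f this, folded h'_def]
  define c where "c = (norm (h' x - h' y))\<^sup>2 / (2 * (L - \<mu>))"
  have "inner (x - y) (h' x - h' y) \<ge> 2 * c"
    using B[of x y] B[of y x] unfolding norm_minus_commute[of "h' y"] c_def[symmetric]
    by (simp add: inner_diff_left inner_diff_right)
  then have le: "(norm (h' x - h' y))\<^sup>2 \<le> (L - \<mu>) * inner (x - y) (h' x - h' y)"
    using \<open>\<mu> < L\<close> by (simp add: c_def field_simps)
  define d where "d = x - y"
  have "h' x - h' y = g x y - \<mu> *\<^sub>R d"
    by (simp add: h'_def g_def d_def algebra_simps)
  moreover have "(norm (g x y - \<mu> *\<^sub>R d))\<^sup>2 = (norm (g x y))\<^sup>2 - 2 * \<mu> * inner d (g x y) + \<mu> * \<mu> * (norm d)\<^sup>2"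
    and "inner d (g x y - \<mu> *\<^sub>R d) = inner d (g x y) - \<mu> * (norm d)\<^sup>2"
    by (simp_all add: power2_norm_eq_inner inner_diff_left inner_diff_right inner_commute)
  ultimately have "(norm (g x y))\<^sup>2 - 2 * \<mu> * inner d (g x y) + \<mu> * \<mu> * (norm d)\<^sup>2
      \<le> (L - \<mu>) * (inner d (g x y) - \<mu> * (norm d)\<^sup>2)"
    using le by (simp add: d_def)
  then show ?thesis
    unfolding d_def[symmetric] by (simp add: algebra_simps)
next
  case True
  have D: "GDERIV f x :> grad f x" for x
    using f(2) by (intro GDERIV_grad) (auto simp: smooth_fun_def)
  have "\<mu> * (norm (x - y))\<^sup>2 \<le> inner (x - y) (g x y)"
    using strongly_convex_lower[OF f(1) D, of x y] strongly_convex_lower[OF f(1) D, of y x]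
    by (simp add: inner_diff_left inner_diff_right norm_minus_commute g_def)
  then have "2 * \<mu> * (\<mu> * (norm (x - y))\<^sup>2) \<le> 2 * \<mu> * inner (x - y) (g x y)"
    using assms(3) by (intro mult_left_mono) auto
  moreover have "norm (g x y) \<le> \<mu> * norm (x - y)"
    using lipschitz_onD[of L UNIV "grad f" x y] f(2) True
    by (auto simp: smooth_fun_def dist_norm g_def)
  then have "(norm (g x y))\<^sup>2 \<le> (\<mu> * norm (x - y))\<^sup>2"
    by (intro power_mono) auto
  ultimately show ?thesis
    using True by (simp add: power_mult_distrib power2_eq_square algebra_simps)
qed

lemma gradient_step_contraction:
  fixes f :: "'a::euclidean_space \<Rightarrow> real"
  assumes f: "strongly_convex \<mu> f" "smooth_fun L f" and "0 < \<mu>" "\<mu> \<le> L"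
    and \<alpha>: "0 \<le> \<alpha>" "\<alpha> \<le> 2 / (\<mu> + L)"
  shows "(norm ((x - \<alpha> *\<^sub>R grad f x) - (y - \<alpha> *\<^sub>R grad f y)))\<^sup>2
    \<le> (1 - 2 * \<alpha> * \<mu> * L / (\<mu> + L)) * (norm (x - y))\<^sup>2"
proof -
  define d g where "d = x - y" and "g = grad f x - grad f y"
  have pos: "0 < \<mu> + L" using assms by simp
  have c: "\<mu> * L * (norm d)\<^sup>2 + (norm g)\<^sup>2 \<le> (\<mu> + L) * inner d g"
    using gradient_cocoercive[OF f, of x y] assms by (simp add: d_def g_def)
  have "2 * \<alpha> / (\<mu> + L) * (\<mu> * L * (norm d)\<^sup>2 + (norm g)\<^sup>2) \<le> 2 * \<alpha> / (\<mu> + L) * ((\<mu> + L) * inner d g)"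
    using pos \<alpha> by (intro mult_left_mono c) auto
  then have "2 * \<alpha> / (\<mu> + L) * (\<mu> * L * (norm d)\<^sup>2) + \<alpha> * (2 / (\<mu> + L)) * (norm g)\<^sup>2 \<le> 2 * \<alpha> * inner d g"
    using pos by (simp add: distrib_left mult_ac)
  \<comment> \<open>Here \<open>\<alpha> \<le> 2 / (\<mu> + L)\<close> enters: the second-order term
    in \<open>g\<close> is absorbed by the one that cocoercivity provides.\<close>
  moreover have "\<alpha> * \<alpha> * (norm g)\<^sup>2 \<le> \<alpha> * (2 / (\<mu> + L)) * (norm g)\<^sup>2"
    using \<alpha> by (intro mult_right_mono mult_left_mono) auto
  moreover have "(norm (d - \<alpha> *\<^sub>R g))\<^sup>2 = (norm d)\<^sup>2 - 2 * \<alpha> * inner d g + \<alpha> * \<alpha> * (norm g)\<^sup>2"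
    by (simp add: power2_norm_eq_inner inner_diff_left inner_diff_right inner_commute)
  ultimately have "(norm (d - \<alpha> *\<^sub>R g))\<^sup>2 \<le> (norm d)\<^sup>2 - 2 * \<alpha> / (\<mu> + L) * (\<mu> * L * (norm d)\<^sup>2)"
    by linarith
  then have "(norm (d - \<alpha> *\<^sub>R g))\<^sup>2 \<le> (1 - 2 * \<alpha> * \<mu> * L / (\<mu> + L)) * (norm d)\<^sup>2"
    by (simp add: algebra_simps)
  moreover have "(x - \<alpha> *\<^sub>R grad f x) - (y - \<alpha> *\<^sub>R grad f y) = d - \<alpha> *\<^sub>R g"
    by (simp add: d_def g_def algebra_simps)
  ultimately show ?thesis
    by (simp only: d_def)
qed

subsection \<open>The proximal map\<close>

text \<open>Compare \<open>p\<close> with \<open>p + t *\<^sub>R (y - p)\<close>, bound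
  \<open>r\<close> there by convexity, divide by \<open>t\<close> and let \<open>t\<close> tend to
  0.\<close>

lemma composite_minimizer_variational_inequality:
  assumes min: "is_arg_min (\<lambda>y. ereal (g y) + ereal c * r y) (\<lambda>_. True) p"
    and g: "GDERIV g p :> G" and "0 < c" and r: "ereal_convex r"
    and fin: "r p = ereal a" "r y = ereal b"
  shows "c * a \<le> c * b + inner (y - p) G"
proof -
  have "c * (a - b) \<le> (g (p + t *\<^sub>R (y - p)) - g p) / t" if t: "t \<in> {0<..<1}" for t
  proof -
    define z where "z = p + t *\<^sub>R (y - p)"
    have z: "z = (1 - t) *\<^sub>R p + t *\<^sub>R y"
      by (simp add: z_def algebra_simps)
    have "r z \<le> ereal (1 - t) * r p + ereal t * r y"
      using r t unfolding z ereal_convex_def by simp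
    then have "ereal c * r z \<le> ereal c * ereal ((1 - t) * a + t * b)"
      using \<open>0 < c\<close> by (intro ereal_mult_left_mono) (auto simp: fin)
    moreover have "ereal (g p) + ereal c * r p \<le> ereal (g z) + ereal c * r z"
      using min by (simp add: is_arg_min_linorder)
    ultimately have "ereal (g p) + ereal c * r p \<le> ereal (g z) + ereal c * ereal ((1 - t) * a + t * b)"
      by (meson add_left_mono order_trans)
    then have "g p + c * a \<le> g z + c * ((1 - t) * a + t * b)"
      by (simp add: fin)
    then have "t * (c * (a - b)) \<le> g z - g p" by (simp add: algebra_simps)
    then show ?thesis using t by (simp add: z_def field_simps)
  qed
  then have "eventually (\<lambda>t. c * (a - b) \<le> (g (p + t *\<^sub>R (y - p)) - g p) / t) (at_right 0)"
    by (auto simp: eventually_at_right_field intro!: exI[of _ 1])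
  then have "c * (a - b) \<le> inner (y - p) G"
    by (intro tendsto_lowerbound[OF GDERIV_line_quotient[OF g]]) auto
  then show ?thesis by (simp add: algebra_simps)
qed

text \<open>The infimum is taken over the part of the epigraph of \<open>r\<close> below a fixed level, which the affine
  minorant makes compact.\<close>
lemma prox_objective_attains_min:
  fixes r :: "'a::euclidean_space \<Rightarrow> ereal"
  assumes closed: "ereal_closed r" and x0: "r x0 = ereal t0" and "0 < \<alpha>"
    and minorant: "\<And>y. ereal (a + inner y g) \<le> r y"
  shows "\<exists>y. is_arg_min (\<lambda>y. ereal \<alpha> * r y + ereal (1 / 2 * (norm (y - x))\<^sup>2)) (\<lambda>_. True) y"
proof -
  \<comment> \<open>Replacing \<open>r y\<close> by a real \<open>t\<close> above it makes the
    objective continuous; lower semicontinuity of \<open>r\<close> enters as closedness of the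
    epigraph.\<close>
  define \<phi> where "\<phi> q = \<alpha> * snd q + 1 / 2 * (norm (fst q - x))\<^sup>2" for q :: "'a \<times> real"
  define K where "K = {(y, t). r y \<le> ereal t} \<inter> {q. \<phi> q \<le> \<phi> (x0, t0)}"
  have cont: "continuous_on S \<phi>" for S
    unfolding \<phi>_def by (intro continuous_intros)
  define C where "C = \<phi> (x0, t0) - \<alpha> * (a + inner x g)"
  \<comment> \<open>Chosen so that no \<open>s > R\<close> satisfies
    \<open>s * s \<le> 2 * C + 2 * \<alpha> * norm g * s\<close>; the summand 1 ensures
    \<open>R \<ge> 1\<close>.\<close>
  define R where "R = \<bar>2 * C\<bar> + 2 * \<alpha> * norm g + 1"
  have "K \<subseteq> cball x R \<times> {a + inner x g - R * norm g..\<phi> (x0, t0) / \<alpha>}"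
  proof (clarify, intro conjI)
    fix y t assume "(y, t) \<in> K"
    then have t: "r y \<le> ereal t" "\<phi> (y, t) \<le> \<phi> (x0, t0)" by (auto simp: K_def)
    define s where "s = norm (y - x)"
    have "inner y g = inner x g + inner (y - x) g" by (simp add: inner_diff_left)
    moreover have "\<bar>inner (y - x) g\<bar> \<le> s * norm g" unfolding s_def by (rule Cauchy_Schwarz_ineq2)
    moreover have "ereal (a + inner y g) \<le> ereal t"
      using minorant t(1) by (rule order_trans)
    ultimately have t_ge: "a + inner x g - s * norm g \<le> t" by simp
    have "\<alpha> * (a + inner x g - s * norm g) \<le> \<alpha> * t"
      using t_ge \<open>0 < \<alpha>\<close> by simp
    then have sC: "s * s \<le> 2 * C + 2 * \<alpha> * norm g * s"
      using t(2) by (simp add: \<phi>_def C_def s_def power2_eq_square algebra_simps)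
    have "s \<le> R"
    proof (rule ccontr)
      assume "\<not> s \<le> R"
      moreover have "R \<ge> 1" using \<open>0 < \<alpha>\<close> by (simp add: R_def)
      ultimately have s: "s > R" "s \<ge> 1" by auto
      then have "s * R < s * s" by simp
      moreover have "s * R = s * \<bar>2 * C\<bar> + 2 * \<alpha> * norm g * s + s"
        by (simp add: R_def algebra_simps)
      moreover have "1 * \<bar>2 * C\<bar> \<le> s * \<bar>2 * C\<bar>"
        using s by (intro mult_right_mono) auto
      ultimately show False using sC s by linarith
    qed
    then show "y \<in> cball x R" by (simp add: s_def dist_norm norm_minus_commute)
    have "s * norm g \<le> R * norm g" using \<open>s \<le> R\<close> by (intro mult_right_mono) auto
    moreover have "\<alpha> * t \<le> \<phi> (y, t)" by (simp add: \<phi>_def)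
    then have "t \<le> \<phi> (x0, t0) / \<alpha>"
      using t(2) \<open>0 < \<alpha>\<close> by (simp add: field_simps)
    ultimately show "t \<in> {a + inner x g - R * norm g..\<phi> (x0, t0) / \<alpha>}"
      using t_ge by simp
  qed
  then have "bounded K"
    by (rule bounded_subset[rotated]) (intro bounded_Times bounded_cball bounded_closed_interval)
  moreover have "closed K"
    using closed unfolding K_def ereal_closed_def
    by (intro closed_Int closed_Collect_le cont continuous_on_const)
  ultimately have "compact K" by (simp add: compact_eq_bounded_closed)
  moreover have "(x0, t0) \<in> K" by (simp add: K_def x0)
  ultimately obtain y t where yt: "(y, t) \<in> K" "\<And>q. q \<in> K \<Longrightarrow> \<phi> (y, t) \<le> \<phi> q"
    using continuous_attains_inf[OF _ _ cont, of K] by (metis empty_iff surj_pair)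
  \<comment> \<open>Points of the epigraph outside \<open>K\<close> exceed the level
    \<open>\<phi> (x0, t0)\<close>, which is at least the minimum over \<open>K\<close>.\<close>
  have least: "\<phi> (y, t) \<le> \<phi> (y', t')" if "r y' \<le> ereal t'" for y' t'
    using yt that by (cases "(y', t') \<in> K") (auto simp: K_def)
  have "ereal \<alpha> * r y + ereal (1 / 2 * (norm (y - x))\<^sup>2) \<le> ereal \<alpha> * r y' + ereal (1 / 2 * (norm (y' - x))\<^sup>2)" for y'
  proof (cases "r y'")
    case (real t')
    have "ereal \<alpha> * r y \<le> ereal \<alpha> * ereal t"
      using yt(1) \<open>0 < \<alpha>\<close> by (intro ereal_mult_left_mono) (auto simp: K_def)
    then have "ereal \<alpha> * r y + ereal (1 / 2 * (norm (y - x))\<^sup>2) \<le> ereal \<alpha> * ereal t + ereal (1 / 2 * (norm (y - x))\<^sup>2)"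
      by (rule add_right_mono)
    also have "\<dots> = ereal (\<phi> (y, t))" by (simp add: \<phi>_def)
    also have "\<dots> \<le> ereal (\<phi> (y', t'))" using least[of y' t'] real by simp
    finally show ?thesis by (simp add: \<phi>_def real)
  next
    case PInf
    then show ?thesis using \<open>0 < \<alpha>\<close> by simp
  next
    case MInf
    then show ?thesis using minorant[of y'] by simp
  qed
  then show ?thesis by (auto simp: is_arg_min_linorder)
qed

lemma GDERIV_half_norm_sq:
  fixes x :: "'a::real_inner"
  shows "GDERIV (\<lambda>y. 1 / 2 * (norm (y - x))\<^sup>2) p :> p - x"
  unfolding gderiv_def power2_norm_eq_inner
  by (rule derivative_eq_intros refl | simp add: inner_commute inner_diff_left inner_diff_right fun_eq_iff)+

text \<open>The optimality condition of \<open>xstar\<close> says that \<open>xstar = prox \<alpha> r (xstar - \<alpha> G)\<close>, so this is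
  nonexpansiveness of the proximal map.\<close>
lemma prox_dist_minimizer:
  fixes r :: "'a::euclidean_space \<Rightarrow> ereal"
  assumes r: "ereal_convex r" "ereal_closed r" "ereal_proper r" and "0 < \<alpha>"
    and min: "is_arg_min (\<lambda>y. ereal (F y) + r y) (\<lambda>_. True) xstar" and F: "GDERIV F xstar :> G"
  shows "norm (prox \<alpha> r x - xstar) \<le> norm (x - (xstar - \<alpha> *\<^sub>R G))"
proof -
  obtain y0 where y0: "r y0 \<noteq> \<infinity>" and ninf: "r y \<noteq> -\<infinity>" for y
    using r(3) by (auto simp: ereal_proper_def)
  \<comment> \<open>A minimizer has a finite value of \<open>r\<close> because it does no worse than
    \<open>y0\<close>.\<close>
  have finite: "\<exists>t. r p = ereal t" if "ereal u + ereal c * r p \<le> ereal v + ereal c * r y0" "0 < c" for p u v c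
    using that y0 ninf[of y0] ninf[of p] by (cases "r p"; cases "r y0") auto
  have min': "is_arg_min (\<lambda>y. ereal (F y) + ereal 1 * r y) (\<lambda>_. True) xstar"
    using min by (simp add: one_ereal_def[symmetric])
  obtain tstar where tstar: "r xstar = ereal tstar"
    using finite[of "F xstar" 1 xstar "F y0"] min' by (auto simp: is_arg_min_linorder)
  have VI: "tstar \<le> t + inner (y - xstar) G" if "r y = ereal t" for y t
    using composite_minimizer_variational_inequality[OF min' F _ r(1) tstar that] by simp
  \<comment> \<open>Optimality of \<open>xstar\<close>, read as an affine lower bound on
    \<open>r\<close> with slope \<open>- G\<close>; this yields the existence of the prox
    point.\<close>
  have minorant: "ereal ((tstar + inner xstar G) + inner y (- G)) \<le> r y" for y
    using VI[of y] ninf[of y] by (cases "r y") (auto simp: inner_diff_left)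
  define p where "p = prox \<alpha> r x"
  \<comment> \<open>\<open>prox\<close> is a choice operator, so its minimizing property follows
    only from the existence of a minimizer.\<close>
  have "is_arg_min (\<lambda>y. ereal \<alpha> * r y + ereal (1 / 2 * (norm (y - x))\<^sup>2)) (\<lambda>_. True) p"
    unfolding p_def prox_def arg_min_def
    by (rule someI_ex[OF prox_objective_attains_min[OF r(2) tstar \<open>0 < \<alpha>\<close> minorant]])
  then have p: "is_arg_min (\<lambda>y. ereal (1 / 2 * (norm (y - x))\<^sup>2) + ereal \<alpha> * r y) (\<lambda>_. True) p"
    by (simp add: add.commute)
  obtain t where t: "r p = ereal t"
    using finite[of "1 / 2 * (norm (p - x))\<^sup>2" \<alpha> p "1 / 2 * (norm (y0 - x))\<^sup>2"] p \<open>0 < \<alpha>\<close>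
    by (auto simp: is_arg_min_linorder)
  \<comment> \<open>Optimality of \<open>p\<close> is tested at \<open>xstar\<close> and that of
    \<open>xstar\<close> at \<open>p\<close>; in the sum the values of \<open>r\<close>
    cancel.\<close>
  have "\<alpha> * t \<le> \<alpha> * tstar + inner (xstar - p) (p - x)"
    by (rule composite_minimizer_variational_inequality[OF p GDERIV_half_norm_sq \<open>0 < \<alpha>\<close> r(1) t tstar])
  moreover have "\<alpha> * tstar \<le> \<alpha> * (t + inner (p - xstar) G)"
    using VI[OF t] \<open>0 < \<alpha>\<close> by simp
  ultimately have "inner (p - xstar) (p - xstar) \<le> inner (p - xstar) (x - (xstar - \<alpha> *\<^sub>R G))"
    by (simp add: inner_diff_left inner_diff_right distrib_left inner_commute algebra_simps)
  also have "\<dots> \<le> norm (p - xstar) * norm (x - (xstar - \<alpha> *\<^sub>R G))"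
    by (rule norm_cauchy_schwarz)
  finally show ?thesis
    unfolding p_def[symmetric] power2_norm_eq_inner[symmetric]
    by (cases "p = xstar") (auto simp: power2_eq_square)
qed

subsection \<open>Sweeps over the blocks\<close>

text \<open>The sequence \<open>harm m - ln m\<close> is decreasing and equals 1 at
  \<open>m = 1\<close>.\<close>

lemma harm_le_ln_plus_1:
  assumes "n \<ge> 1"
  shows "harm n \<le> ln (real n) + 1"
  using euler_mascheroni_sequence_decreasing[of 1 n] assms by (simp add: harm_expand)

lemma norm_sum_power2_le:
  fixes v :: "'i \<Rightarrow> 'a::real_normed_vector"
  shows "(norm (\<Sum>i\<in>I. v i))\<^sup>2 \<le> real (card I) * (\<Sum>i\<in>I. (norm (v i))\<^sup>2)"
proof -
  have "(norm (\<Sum>i\<in>I. v i))\<^sup>2 \<le> (\<Sum>i\<in>I. norm (v i))\<^sup>2"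
    by (intro power_mono norm_sum) auto
  also have "\<dots> \<le> (\<Sum>i\<in>I. (norm (v i))\<^sup>2) * real (card I)"
    by (rule sum_squared_le_sum_of_squares)
  finally show ?thesis by (simp add: mult.commute)
qed

text \<open>Cauchy-Schwarz with each term split into \<open>1 / sqrt i\<close> and
  \<open>sqrt i * norm (v i)\<close>; the squared first factors sum to
  \<open>harm n\<close>.\<close>

lemma norm_sum_power2_le_harm:
  fixes v :: "nat \<Rightarrow> 'a::real_normed_vector"
  shows "(norm (\<Sum>i=1..n. v i))\<^sup>2 \<le> harm n * (\<Sum>i=1..n. real i * (norm (v i))\<^sup>2)"
proof -
  have "(\<Sum>i=1..n. norm (v i)) = (\<Sum>i=1..n. (1 / sqrt (real i)) * (sqrt (real i) * norm (v i)))"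
    by (intro sum.cong) auto
  then have "(norm (\<Sum>i=1..n. v i))\<^sup>2 \<le> (\<Sum>i=1..n. (1 / sqrt (real i)) * (sqrt (real i) * norm (v i)))\<^sup>2"
    using norm_sum[of v "{1..n}"] by (intro power_mono) auto
  also have "\<dots> \<le> (\<Sum>i=1..n. (1 / sqrt (real i))\<^sup>2) * (\<Sum>i=1..n. (sqrt (real i) * norm (v i))\<^sup>2)"
    by (rule Cauchy_Schwarz_ineq_sum)
  also have "\<dots> = harm n * (\<Sum>i=1..n. real i * (norm (v i))\<^sup>2)"
    by (simp add: harm_def power_mult_distrib power_divide inverse_eq_divide)
  finally show ?thesis .
qed

text \<open>The gap between the two sides is exactly
  \<open>u * (1 - u) * (norm (x - y))\<^sup>2\<close>.\<close>

lemma norm_convex_combination_power2_le: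
  fixes x y :: "'a::real_inner"
  assumes "0 \<le> u" "u \<le> 1"
  shows "(norm ((1 - u) *\<^sub>R x + u *\<^sub>R y))\<^sup>2 \<le> (1 - u) * (norm x)\<^sup>2 + u * (norm y)\<^sup>2"
proof -
  have "(1 - u) * (norm x)\<^sup>2 + u * (norm y)\<^sup>2 - (norm ((1 - u) *\<^sub>R x + u *\<^sub>R y))\<^sup>2 = u * (1 - u) * (norm (x - y))\<^sup>2"
    by (simp add: power2_norm_eq_inner inner_diff_left inner_diff_right inner_add_left inner_add_right
        inner_commute algebra_simps)
  moreover have "u * (1 - u) * (norm (x - y))\<^sup>2 \<ge> 0" using assms by simp
  ultimately show ?thesis by linarith
qed

text \<open>In the next two lemmas \<open>a i\<close> and \<open>b i\<close> are the errors of the block visited in step \<open>i\<close> before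
  and after the epoch; the hypothesis says that the new error is at most \<open>\<rho>\<close> times the current mean.\<close>
lemma cyclic_sweep_weighted_le:
  fixes a b :: "nat \<Rightarrow> real"
  assumes sweep: "\<And>j. j \<in> {1..n} \<Longrightarrow> b j \<le> \<rho> / real n * (\<Sum>i=1..n. if i < j then b i else a i)"
    and "\<rho> \<le> 1" and b: "\<And>j. 0 \<le> b j"
  shows "(\<Sum>i=1..n. real i / real n * b i) \<le> \<rho> * (\<Sum>i=1..n. real i / real n * a i)"
proof -
  have inner: "(\<Sum>j=1..n. if i < j then b i else a i) = real (n - i) * b i + real i * a i"
    if "i \<in> {1..n}" for i
  proof -
    have "{1..n} \<inter> {j. i < j} = {Suc i..n}" "{1..n} \<inter> - {j. i < j} = {1..i}"
      using that by auto
    then show ?thesis by (simp add: sum.If_cases)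
  qed
  have "(\<Sum>j=1..n. b j) \<le> (\<Sum>j=1..n. \<rho> / real n * (\<Sum>i=1..n. if i < j then b i else a i))"
    by (intro sum_mono sweep)
  also have "\<dots> = \<rho> / real n * (\<Sum>i=1..n. \<Sum>j=1..n. if i < j then b i else a i)"
    unfolding sum_distrib_left[symmetric] by (subst sum.swap) simp
  also have "(\<Sum>i=1..n. \<Sum>j=1..n. if i < j then b i else a i) = (\<Sum>i=1..n. real (n - i) * b i + real i * a i)"
    by (intro sum.cong inner) auto
  also have "\<rho> / real n * \<dots> = \<rho> * (\<Sum>i=1..n. real (n - i) / real n * b i) + \<rho> * (\<Sum>i=1..n. real i / real n * a i)"
    by (simp add: sum.distrib sum_distrib_left distrib_left)
  \<comment> \<open>The factor \<open>\<rho>\<close> is given up on the new errors, so that moving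
    them to the left reduces the weight of \<open>b i\<close> from 1 to
    \<open>i / n\<close>.\<close>
  also have "\<rho> * (\<Sum>i=1..n. real (n - i) / real n * b i) \<le> 1 * (\<Sum>i=1..n. real (n - i) / real n * b i)"
    using \<open>\<rho> \<le> 1\<close> b by (intro mult_right_mono sum_nonneg) auto
  finally have "(\<Sum>j=1..n. b j) - (\<Sum>i=1..n. real (n - i) / real n * b i) \<le> \<rho> * (\<Sum>i=1..n. real i / real n * a i)"
    by simp
  moreover have "(\<Sum>j=1..n. b j) - (\<Sum>i=1..n. real (n - i) / real n * b i) = (\<Sum>i=1..n. real i / real n * b i)"
    unfolding sum_subtractf[symmetric] by (intro sum.cong) (auto simp: field_simps of_nat_diff)
  ultimately show ?thesis by simp
qed

lemma cyclic_sweep_constant_le: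
  fixes b :: "nat \<Rightarrow> real"
  assumes sweep: "\<And>j. j \<in> {1..n} \<Longrightarrow> b j \<le> \<rho> / real n * (\<Sum>i=1..n. if i < j then b i else c)"
    and "0 \<le> \<rho>" "\<rho> \<le> 1" "0 \<le> c" and "j \<in> {1..n}"
  shows "b j \<le> \<rho> * c"
  using \<open>j \<in> {1..n}\<close>
proof (induction j rule: less_induct)
  case (less j)
  \<comment> \<open>By induction the errors renewed so far are at most \<open>\<rho> * c\<close>,
    hence at most \<open>c\<close>, and the current mean never exceeds \<open>c\<close>.\<close>
  have "\<rho> * c \<le> c" using assms by (simp add: mult_left_le_one_le)
  then have "(\<Sum>i=1..n. if i < j then b i else c) \<le> (\<Sum>i=1..n. c)"
    using less by (intro sum_mono) (auto intro: order_trans)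
  then have "\<rho> / real n * (\<Sum>i=1..n. if i < j then b i else c) \<le> \<rho> / real n * (real n * c)"
    using assms by (intro mult_left_mono) auto
  moreover have "\<rho> / real n * (real n * c) = \<rho> * c"
    using less.prems by simp
  ultimately show ?case using sweep[OF less.prems] by linarith
qed

text \<open>Composition with the transposition of \<open>i\<close> and \<open>j\<close> permutes the
  permutations, so the sum is the same for every position; summed over all positions, each
  permutation contributes the full sum of \<open>\<phi>\<close>.\<close>

lemma sum_permutations_apply:
  fixes \<phi> :: "'i \<Rightarrow> real"
  assumes "finite S" "j \<in> S"
  shows "(\<Sum>p | p permutes S. \<phi> (p j)) = real (card {p. p permutes S}) * ((\<Sum>i\<in>S. \<phi> i) / real (card S))"
proof -
  have const: "(\<Sum>p | p permutes S. \<phi> (p i)) = (\<Sum>p | p permutes S. \<phi> (p j))" if "i \<in> S" for i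
    using sum_permutations_compose_right[OF permutes_swap_id[OF that \<open>j \<in> S\<close>], of "\<lambda>p. \<phi> (p i)"]
    by simp
  have "real (card S) * (\<Sum>p | p permutes S. \<phi> (p j)) = (\<Sum>i\<in>S. \<Sum>p | p permutes S. \<phi> (p i))"
    by (simp add: const)
  also have "\<dots> = (\<Sum>p | p permutes S. \<Sum>i\<in>S. \<phi> (p i))"
    by (rule sum.swap)
  also have "\<dots> = (\<Sum>p | p permutes S. \<Sum>i\<in>S. \<phi> i)"
    by (intro sum.cong refl sum.permute[symmetric, unfolded o_def]) simp
  finally have "real (card S) * (\<Sum>p | p permutes S. \<phi> (p j)) = real (card {p. p permutes S}) * (\<Sum>i\<in>S. \<phi> i)"
    by simp
  moreover have "card S > 0" using assms by (auto simp: card_gt_0_iff)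
  ultimately show ?thesis
    by (simp add: field_simps)
qed

subsection \<open>Epochs of the algorithm\<close>

text \<open>Separates the dynamics of the table from the analysis of \<open>f\<close> and
  \<open>r\<close>, which enters through two distance estimates. By the first, \<open>xstar\<close>
  is the prox of the mean of \<open>zstar\<close>.\<close>

locale dfinito_contraction =
  fixes n :: nat and \<alpha> \<theta> \<rho> :: real and f :: "nat \<Rightarrow> 'a::real_inner \<Rightarrow> real" and r :: "'a \<Rightarrow> ereal"
    and z0 :: "nat \<Rightarrow> 'a" and xstar :: 'a and zstar :: "nat \<Rightarrow> 'a"
  assumes n: "1 \<le> n" and theta: "0 \<le> \<theta>" "\<theta> \<le> 1" and rho: "0 \<le> \<rho>" "\<rho> \<le> 1"
    and prox_dist: "norm (prox \<alpha> r x - xstar) \<le> norm (x - (\<Sum>i=1..n. zstar i) /\<^sub>R real n)"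
    and grad_dist: "i \<in> {1..n} \<Longrightarrow>
      (norm (x - \<alpha> *\<^sub>R grad (f i) x - zstar i))\<^sup>2 \<le> \<rho> * (norm (x - xstar))\<^sup>2"
begin

text \<open>The average is maintained incrementally; this invariant lets its error be bounded by the
  block errors.\<close>

definition consistent :: "(nat \<Rightarrow> 'a) \<times> 'a \<Rightarrow> bool" where
  "consistent s \<longleftrightarrow> snd s = (\<Sum>i=1..n. fst s i) /\<^sub>R real n"

definition err :: "(nat \<Rightarrow> 'a) \<times> 'a \<Rightarrow> nat \<Rightarrow> real" where
  "err s i = (norm (fst s i - zstar i))\<^sup>2"

primrec epoch :: "(nat \<Rightarrow> nat) \<Rightarrow> (nat \<Rightarrow> 'a) \<times> 'a \<Rightarrow> nat \<Rightarrow> (nat \<Rightarrow> 'a) \<times> 'a" where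
  "epoch p s 0 = s"
| "epoch p s (Suc j) = dfinito_step n \<alpha> f r (p (Suc j)) (epoch p s j)"

abbreviation next_state :: "(nat \<Rightarrow> nat) \<Rightarrow> (nat \<Rightarrow> 'a) \<times> 'a \<Rightarrow> (nat \<Rightarrow> 'a) \<times> 'a" where
  "next_state p s \<equiv> dfinito_damp \<theta> s (epoch p s n)"

abbreviation run :: "(nat \<Rightarrow> nat \<Rightarrow> nat) \<Rightarrow> nat \<Rightarrow> (nat \<Rightarrow> 'a) \<times> 'a" where
  "run \<sigma> k \<equiv> dfinito_state n \<alpha> \<theta> f r z0 (epoch_index n \<sigma>) (k * n)"

lemma err_nonneg: "0 \<le> err s i"
  by (simp add: err_def)

section \<open>The average and the table during one epoch\<close>

lemma consistent_step:
  assumes "consistent s" "i \<in> {1..n}"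
  shows "consistent (dfinito_step n \<alpha> f r i s)"
proof -
  have "(\<Sum>j=1..n. (z(i := w)) j) = (\<Sum>j=1..n. z j) + (w - z i)" for z :: "nat \<Rightarrow> 'a" and w
    using assms(2) by (simp add: sum.remove[of _ i])
  then show ?thesis
    using assms(1) by (simp add: consistent_def dfinito_step_def Let_def scaleR_add_right)
qed

lemma consistent_epoch:
  assumes "p permutes {1..n}" "consistent s" "j \<le> n"
  shows "consistent (epoch p s j)"
  using assms(3)
proof (induction j)
  case (Suc j)
  then show ?case
    using permutes_in_image[OF assms(1), of "Suc j"] by (auto intro: consistent_step)
qed (simp add: assms)

lemma consistent_damp:
  assumes "consistent s" "consistent s'"
  shows "consistent (dfinito_damp \<theta> s s')"
  using assms by (simp add: consistent_def dfinito_damp_def sum.distrib scaleR_sum_right[symmetric]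
      scaleR_add_right mult.commute)

text \<open>A permutation visits each block once, so what step \<open>i\<close> writes survives
  later steps; by the same injectivity the old value is intact before step \<open>i\<close>.\<close>

lemma epoch_visited:
  assumes p: "p permutes {1..n}" and "i \<in> {1..j}"
  shows "fst (epoch p s j) (p i) = fst (epoch p s i) (p i)"
  using assms(2)
proof (induction j)
  case (Suc j)
  then show ?case
    using permutes_inj[OF p]
    by (cases "i = Suc j") (auto simp: dfinito_step_def Let_def inj_eq)
qed simp

lemma epoch_unvisited:
  assumes p: "p permutes {1..n}" and "j < i"
  shows "fst (epoch p s j) (p i) = fst s (p i)"
  using assms(2) permutes_inj[OF p]
  by (induction j) (auto simp: dfinito_step_def Let_def inj_eq)

section \<open>Error bounds for one epoch\<close>

lemma average_dist:
  assumes "consistent s"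
  shows "(norm (snd s - (\<Sum>i=1..n. zstar i) /\<^sub>R real n))\<^sup>2 = (norm (\<Sum>i=1..n. fst s i - zstar i))\<^sup>2 / (real n)\<^sup>2"
proof -
  have "snd s - (\<Sum>i=1..n. zstar i) /\<^sub>R real n = (\<Sum>i=1..n. fst s i - zstar i) /\<^sub>R real n"
    using assms by (simp add: consistent_def sum_subtractf scaleR_diff_right)
  then show ?thesis
    using n by (simp add: power_mult_distrib power_inverse field_simps)
qed

lemma prox_dist_le_average:
  assumes "consistent s"
  shows "(norm (prox \<alpha> r (snd s) - xstar))\<^sup>2 \<le> (\<Sum>i=1..n. err s i) / real n"
proof -
  have "(norm (prox \<alpha> r (snd s) - xstar))\<^sup>2 \<le> (norm (\<Sum>i=1..n. fst s i - zstar i))\<^sup>2 / (real n)\<^sup>2"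
    using prox_dist[of "snd s"] by (subst average_dist[OF assms, symmetric]) (intro power_mono, auto)
  also have "\<dots> \<le> (real n * (\<Sum>i=1..n. err s i)) / (real n)\<^sup>2"
    using norm_sum_power2_le[of "\<lambda>i. fst s i - zstar i" "{1..n}"]
    by (intro divide_right_mono) (auto simp: err_def)
  finally show ?thesis using n by (simp add: power2_eq_square)
qed

text \<open>Bounds the iterate by the weighted error that contracts under a fixed order. Of the two
  factors \<open>n\<close> in the denominator, one goes into the weights.\<close>

lemma prox_dist_le_weighted:
  assumes "consistent s" "p permutes {1..n}"
  shows "(norm (prox \<alpha> r (snd s) - xstar))\<^sup>2
    \<le> (ln (real n) + 1) / real n * (\<Sum>i=1..n. real i / real n * err s (p i))"
proof -
  have "(norm (prox \<alpha> r (snd s) - xstar))\<^sup>2 \<le> (norm (\<Sum>i=1..n. fst s i - zstar i))\<^sup>2 / (real n)\<^sup>2"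
    using prox_dist[of "snd s"] by (subst average_dist[OF assms(1), symmetric]) (intro power_mono, auto)
  also have "(\<Sum>i=1..n. fst s i - zstar i) = (\<Sum>i=1..n. fst s (p i) - zstar (p i))"
    by (subst sum.permute[OF assms(2)]) (simp add: o_def)
  also have "(norm \<dots>)\<^sup>2 / (real n)\<^sup>2 \<le> (harm n * (\<Sum>i=1..n. real i * err s (p i))) / (real n)\<^sup>2"
    using norm_sum_power2_le_harm[of "\<lambda>i. fst s (p i) - zstar (p i)" n]
    by (intro divide_right_mono) (auto simp: err_def)
  also have "\<dots> \<le> ((ln (real n) + 1) * (\<Sum>i=1..n. real i * err s (p i))) / (real n)\<^sup>2"
    using harm_le_ln_plus_1[OF n] by (intro divide_right_mono mult_right_mono sum_nonneg) (auto simp: err_nonneg)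
  also have "\<dots> = (ln (real n) + 1) / real n * (\<Sum>i=1..n. real i / real n * err s (p i))"
    by (simp add: power2_eq_square sum_divide_distrib[symmetric])
  finally show ?thesis .
qed

lemma err_step:
  assumes "consistent s" "i \<in> {1..n}"
  shows "err (dfinito_step n \<alpha> f r i s) i \<le> \<rho> * ((\<Sum>i=1..n. err s i) / real n)"
proof -
  have "err (dfinito_step n \<alpha> f r i s) i \<le> \<rho> * (norm (prox \<alpha> r (snd s) - xstar))\<^sup>2"
    using grad_dist[OF assms(2)] by (simp add: err_def dfinito_step_def Let_def)
  also have "\<dots> \<le> \<rho> * ((\<Sum>i=1..n. err s i) / real n)"
    by (intro mult_left_mono prox_dist_le_average assms rho)
  finally show ?thesis .
qed

text \<open>Step \<open>j\<close> acts on the state after \<open>j - 1\<close> updates, in which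
  exactly the blocks at positions below \<open>j\<close> already hold their undamped end-of-epoch
  values. This is the hypothesis of the sweep lemmas.\<close>

lemma err_epoch:
  assumes p: "p permutes {1..n}" and s: "consistent s" and j: "j \<in> {1..n}"
  shows "err (epoch p s n) (p j)
    \<le> \<rho> / real n * (\<Sum>i=1..n. if i < j then err (epoch p s n) (p i) else err s (p i))"
proof -
  obtain k where k: "j = Suc k" using j by (cases j) auto
  have "err (epoch p s n) (p j) = err (dfinito_step n \<alpha> f r (p j) (epoch p s k)) (p j)"
    using epoch_visited[OF p j, of s] by (simp add: err_def k)
  also have "\<dots> \<le> \<rho> * ((\<Sum>i=1..n. err (epoch p s k) i) / real n)"
    using p s j permutes_in_image[OF p, of j] by (intro err_step consistent_epoch) (auto simp: k)
  also have "(\<Sum>i=1..n. err (epoch p s k) i) = (\<Sum>i=1..n. err (epoch p s k) (p i))"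
    by (subst sum.permute[OF p]) (simp add: o_def)
  also have "\<dots> = (\<Sum>i=1..n. if i < j then err (epoch p s n) (p i) else err s (p i))"
    by (intro sum.cong) (use j in \<open>auto simp: err_def k epoch_visited[OF p, of _ n] epoch_visited[OF p, of _ k] epoch_unvisited[OF p] less_Suc_eq_le\<close>)
  finally show ?thesis by simp
qed

lemma err_damp: "err (dfinito_damp \<theta> s s') i \<le> (1 - \<theta>) * err s i + \<theta> * err s' i"
proof -
  have "fst (dfinito_damp \<theta> s s') i - zstar i = (1 - \<theta>) *\<^sub>R (fst s i - zstar i) + \<theta> *\<^sub>R (fst s' i - zstar i)"
    by (simp add: dfinito_damp_def algebra_simps)
  then show ?thesis
    using norm_convex_combination_power2_le[OF theta] by (simp add: err_def)
qed

lemma weighted_err_next_state: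
  assumes p: "p permutes {1..n}" and s: "consistent s"
  shows "(\<Sum>i=1..n. real i / real n * err (next_state p s) (p i))
    \<le> (1 - \<theta> + \<theta> * \<rho>) * (\<Sum>i=1..n. real i / real n * err s (p i))"
proof -
  let ?V = "\<lambda>s. \<Sum>i=1..n. real i / real n * err s (p i)"
  have "?V (next_state p s) \<le> (\<Sum>i=1..n. real i / real n * ((1 - \<theta>) * err s (p i) + \<theta> * err (epoch p s n) (p i)))"
    by (intro sum_mono mult_left_mono err_damp) auto
  also have "\<dots> = (1 - \<theta>) * ?V s + \<theta> * ?V (epoch p s n)"
    by (simp add: sum.distrib sum_distrib_left distrib_left mult.left_commute)
  also have "\<dots> \<le> (1 - \<theta>) * ?V s + \<theta> * (\<rho> * ?V s)"
    using err_epoch[OF p s] theta rho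
    by (intro add_left_mono mult_left_mono cyclic_sweep_weighted_le) (auto simp: err_nonneg)
  finally show ?thesis by (simp add: algebra_simps)
qed

lemma sum_permutations_err_next_state:
  assumes s: "consistent s"
  shows "(\<Sum>p | p permutes {1..n}. \<Sum>i=1..n. err (next_state p s) i)
    \<le> real (card {p. p permutes {1..n}}) * ((1 - \<theta> + \<theta> * \<rho>) * (\<Sum>i=1..n. err s i))"
proof -
  define P where "P = {p. p permutes {1..n}}"
  define N where "N = real (card P)"
  define W where "W = (\<Sum>i=1..n. err s i)"
  have N: "N > 0"
    by (simp add: N_def P_def card_permutations)
  \<comment> \<open>The mean over all orders of the new error at position \<open>j\<close>. The old
    error at any position has mean \<open>W / n\<close>, which serves as the constant
    \<open>c\<close> of the sweep lemma.\<close>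
  define b where "b j = (\<Sum>p\<in>P. err (epoch p s n) (p j)) / N" for j
  have a: "(\<Sum>p\<in>P. err s (p j)) / N = W / real n" if "j \<in> {1..n}" for j
    using sum_permutations_apply[of "{1..n}" j "err s"] that N by (simp add: P_def N_def W_def)
  have b: "b j \<le> \<rho> * (W / real n)" if "j \<in> {1..n}" for j
  proof (rule cyclic_sweep_constant_le[where n = n])
    fix j assume j: "j \<in> {1..n}"
    \<comment> \<open>Whether a position holds a new or an old error depends on \<open>i < j\<close>
      and not on \<open>p\<close>, so the bound can be averaged over \<open>p\<close>.\<close>
    have "b j \<le> (\<Sum>p\<in>P. \<rho> / real n * (\<Sum>i=1..n. if i < j then err (epoch p s n) (p i) else err s (p i))) / N"
      unfolding b_def using N by (intro divide_right_mono sum_mono err_epoch[OF _ s j]) (auto simp: P_def)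
    also have "\<dots> = \<rho> / real n * (\<Sum>i=1..n. (\<Sum>p\<in>P. if i < j then err (epoch p s n) (p i) else err s (p i)) / N)"
      unfolding sum_distrib_left[symmetric] sum_divide_distrib[symmetric] by (subst sum.swap) simp
    also have "(\<Sum>i=1..n. (\<Sum>p\<in>P. if i < j then err (epoch p s n) (p i) else err s (p i)) / N)
        = (\<Sum>i=1..n. if i < j then b i else W / real n)"
      by (intro sum.cong) (auto simp: b_def a)
    finally show "b j \<le> \<rho> / real n * (\<Sum>i=1..n. if i < j then b i else W / real n)" .
  qed (use rho that in \<open>auto simp: W_def intro!: divide_nonneg_nonneg sum_nonneg err_nonneg\<close>)
  have "(\<Sum>p\<in>P. \<Sum>i=1..n. err (next_state p s) i)
      \<le> (\<Sum>p\<in>P. \<Sum>i=1..n. (1 - \<theta>) * err s i + \<theta> * err (epoch p s n) i)"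
    by (intro sum_mono err_damp)
  also have "\<dots> = N * (1 - \<theta>) * W + \<theta> * (\<Sum>p\<in>P. \<Sum>i=1..n. err (epoch p s n) i)"
    by (simp add: sum.distrib sum_distrib_left W_def N_def mult_ac)
  also have "(\<Sum>p\<in>P. \<Sum>i=1..n. err (epoch p s n) i) = (\<Sum>p\<in>P. \<Sum>i=1..n. err (epoch p s n) (p i))"
    by (intro sum.cong refl sum.permute[unfolded o_def]) (simp add: P_def)
  also have "\<dots> = (\<Sum>i=1..n. N * b i)"
    using N by (subst sum.swap) (simp add: b_def)
  also have "N * (1 - \<theta>) * W + \<theta> * \<dots> \<le> N * (1 - \<theta>) * W + \<theta> * (\<Sum>i=1..n. N * (\<rho> * (W / real n)))"
    using N theta by (intro add_left_mono mult_left_mono sum_mono b) auto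
  also have "\<dots> = N * ((1 - \<theta> + \<theta> * \<rho>) * W)"
    using n by (simp add: algebra_simps)
  finally show ?thesis by (simp add: P_def N_def W_def)
qed

section \<open>From the state recursion to whole epochs\<close>

lemma state_within_epoch:
  assumes "j < n"
  shows "dfinito_state n \<alpha> \<theta> f r z0 (epoch_index n \<sigma>) (k * n + j) = epoch (\<sigma> k) (run \<sigma> k) j"
  using assms
proof (induction j)
  case (Suc j)
  \<comment> \<open>Strictly between two multiples of \<open>n\<close> no damping occurs; hence the
    restriction to \<open>j < n\<close>.\<close>
  have "\<not> n dvd Suc (k * n + j)"
    using Suc.prems dvd_add_right_iff[of n "k * n" "Suc j"] by (auto dest: dvd_imp_le)
  moreover have "epoch_index n \<sigma> (Suc (k * n + j)) = \<sigma> k (Suc j)"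
    using epoch_index_eq[of "Suc j" n \<sigma> k] Suc.prems by simp
  ultimately show ?case using Suc by simp
qed simp

lemma run_Suc: "run \<sigma> (Suc k) = next_state (\<sigma> k) (run \<sigma> k)"
proof -
  obtain m where m: "n = Suc m" using n by (cases n) auto
  have eq: "Suc k * n = Suc (k * n + m)" by (simp add: m)
  have "epoch_index n \<sigma> (Suc (k * n + m)) = \<sigma> k n"
    using epoch_index_eq[of n n \<sigma> k] n by (simp add: m)
  moreover have "n dvd Suc (k * n + m)" "Suc (k * n + m) - n = k * n"
    by (simp add: eq[symmetric]) (simp add: m)
  moreover have "epoch p s n = dfinito_step n \<alpha> f r (p n) (epoch p s m)" for p s
    using epoch.simps(2)[of p s m] by (simp only: m[symmetric])
  ultimately show ?thesis
    unfolding eq dfinito_state.simps(2) Let_def using state_within_epoch[of m \<sigma> k] m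
    by (simp only: if_True lessI)
qed

text \<open>The state at the start of epoch \<open>k\<close> depends on the earlier orders alone;
  this makes it independent of the draw for epoch \<open>k\<close>.\<close>

lemma run_cong:
  assumes "\<And>l. l < k \<Longrightarrow> \<sigma> l = \<sigma>' l"
  shows "run \<sigma> k = run \<sigma>' k"
  using assms
proof (induction k)
  case (Suc k)
  then have "run \<sigma> k = run \<sigma>' k" "\<sigma> k = \<sigma>' k" by auto
  then show ?case by (simp only: run_Suc)
qed simp

lemma consistent_run:
  assumes "\<And>l. l < k \<Longrightarrow> \<sigma> l permutes {1..n}"
  shows "consistent (run \<sigma> k)"
  using assms
proof (induction k)
  case 0
  show ?case by (simp add: consistent_def)
next
  case (Suc k)
  then show ?case unfolding run_Suc by (intro consistent_damp consistent_epoch) auto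
qed

lemma weighted_err_run:
  assumes p: "p permutes {1..n}"
  shows "(\<Sum>i=1..n. real i / real n * err (run (\<lambda>_. p) k) (p i))
    \<le> (1 - \<theta> + \<theta> * \<rho>) ^ k * (\<Sum>i=1..n. real i / real n * (norm (z0 (p i) - zstar (p i)))\<^sup>2)"
proof (induction k)
  case 0
  then show ?case by (simp add: err_def)
next
  case (Suc k)
  have "(\<Sum>i=1..n. real i / real n * err (run (\<lambda>_. p) (Suc k)) (p i))
      \<le> (1 - \<theta> + \<theta> * \<rho>) * (\<Sum>i=1..n. real i / real n * err (run (\<lambda>_. p) k) (p i))"
    unfolding run_Suc by (intro weighted_err_next_state consistent_run p)
  also have "\<dots> \<le> (1 - \<theta> + \<theta> * \<rho>) * ((1 - \<theta> + \<theta> * \<rho>) ^ k *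
      (\<Sum>i=1..n. real i / real n * (norm (z0 (p i) - zstar (p i)))\<^sup>2))"
    using theta rho by (intro mult_left_mono Suc.IH) auto
  finally show ?case by simp
qed

end

subsection \<open>Random reshuffling\<close>

context prob_space
begin

text \<open>\<open>H\<close> factors through the first \<open>k\<close> coordinates, which range
  over a finite discrete space, so it is bounded and measurable without further assumptions.\<close>

lemma integrable_finite_past:
  fixes H :: "(nat \<Rightarrow> 'b) \<Rightarrow> real"
  assumes X: "\<And>l. X l \<in> measurable M (count_space P)" and "finite P"
    and past: "\<And>\<sigma> \<sigma>'. (\<And>l. l < k \<Longrightarrow> \<sigma> l = \<sigma>' l) \<Longrightarrow> H \<sigma> = H \<sigma>'"
  shows "integrable M (\<lambda>\<omega>. H (\<lambda>l. X l \<omega>))"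
proof -
  define R where "R \<omega> = restrict (\<lambda>l. X l \<omega>) {..<k}" for \<omega>
  define Q where "Q = PiE {..<k} (\<lambda>_. P)"
  have "R \<in> measurable M (PiM {..<k} (\<lambda>_. count_space P))"
    unfolding R_def by (intro measurable_restrict X)
  also have "PiM {..<k} (\<lambda>_. count_space P) = count_space Q"
    unfolding Q_def by (intro count_space_PiM_finite) (auto simp: \<open>finite P\<close> countable_finite)
  finally have R: "R \<in> measurable M (count_space Q)" .
  have "finite Q" unfolding Q_def by (intro finite_PiE \<open>finite P\<close>) simp
  have "integrable M (\<lambda>\<omega>. H (R \<omega>))"
  proof (rule integrable_const_bound)
    show "AE \<omega> in M. norm (H (R \<omega>)) \<le> Max ((\<lambda>\<sigma>. norm (H \<sigma>)) ` Q)"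
      using measurable_space[OF R] \<open>finite Q\<close> by (intro AE_I2 Max_ge) auto
    show "(\<lambda>\<omega>. H (R \<omega>)) \<in> borel_measurable M"
      by (rule measurable_compose[OF R]) simp
  qed
  moreover have "H (R \<omega>) = H (\<lambda>l. X l \<omega>)" for \<omega>
    by (rule past) (simp add: R_def)
  ultimately show ?thesis by simp
qed

text \<open>Averages out the draw \<open>k\<close> given the past: split by the value
  \<open>p\<close> of \<open>X k\<close>, use that its indicator is independent of the past, and
  insert the probability \<open>1 / card P\<close>.\<close>

lemma expectation_indep_uniform_next:
  fixes \<Phi> :: "(nat \<Rightarrow> 'b) \<Rightarrow> 'b \<Rightarrow> real"
  assumes indep: "indep_vars (\<lambda>_. count_space P) X UNIV" and "finite P"
    and unif: "distr M (count_space P) (X k) = uniform_count_measure P"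
    and past: "\<And>\<sigma> \<sigma>' p. (\<And>l. l < k \<Longrightarrow> \<sigma> l = \<sigma>' l) \<Longrightarrow> \<Phi> \<sigma> p = \<Phi> \<sigma>' p"
  shows "expectation (\<lambda>\<omega>. \<Phi> (\<lambda>l. X l \<omega>) (X k \<omega>))
    = expectation (\<lambda>\<omega>. (\<Sum>p\<in>P. \<Phi> (\<lambda>l. X l \<omega>) p) / real (card P))"
proof -
  have X: "X l \<in> measurable M (count_space P)" for l
    using indep by (auto simp: indep_vars_def)
  have int: "integrable M (\<lambda>\<omega>. \<Phi> (\<lambda>l. X l \<omega>) p)" for p
    by (rule integrable_finite_past[OF X \<open>finite P\<close>, of k]) (rule past)
  define I where "I p \<omega> = (indicator {p} (X k \<omega>) :: real)" for p \<omega>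
  have int_I: "integrable M (I p)" for p
    unfolding I_def by (rule integrable_finite_past[OF X \<open>finite P\<close>, of "Suc k" "\<lambda>\<sigma>. indicator {p} (\<sigma> k)"]) simp
  have E_I: "expectation (I p) = 1 / real (card P)" if "p \<in> P" for p
  proof -
    have "expectation (I p) = (\<integral>q. indicator {p} q \<partial>distr M (count_space P) (X k))"
      unfolding I_def by (subst integral_distr[OF X]) auto
    also have "\<dots> = measure (uniform_count_measure P) {p}"
      using that by (subst unif) (simp add: space_uniform_count_measure)
    also have "\<dots> = 1 / real (card P)"
      using that \<open>finite P\<close> by (subst measure_uniform_count_measure) auto
    finally show ?thesis .
  qed
  have ind: "indep_var borel (\<lambda>\<omega>. \<Phi> (\<lambda>l. X l \<omega>) p) borel (I p)" for p
  proof -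
    have meas: "\<And>J. finite J \<Longrightarrow> h \<in> borel_measurable (PiM J (\<lambda>_. count_space P))"
      for h :: "(nat \<Rightarrow> 'b) \<Rightarrow> real"
      by (subst count_space_PiM_finite) (auto simp: \<open>finite P\<close> countable_finite)
    \<comment> \<open>The two factors read disjoint sets of coordinates, those below
      \<open>k\<close> and \<open>k\<close> itself, so independence passes to them.\<close>
    have "indep_var borel ((\<lambda>\<sigma>. \<Phi> \<sigma> p) \<circ> (\<lambda>\<omega>. restrict (\<lambda>i. X i \<omega>) {..<k}))
        borel ((\<lambda>\<sigma>. indicator {p} (\<sigma> k)) \<circ> (\<lambda>\<omega>. restrict (\<lambda>i. X i \<omega>) {k}))"
      by (rule indep_var_compose[OF indep_var_restrict[OF indep]]) (auto intro: meas)
    moreover have "(\<lambda>\<sigma>. \<Phi> \<sigma> p) \<circ> (\<lambda>\<omega>. restrict (\<lambda>i. X i \<omega>) {..<k}) = (\<lambda>\<omega>. \<Phi> (\<lambda>l. X l \<omega>) p)"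
      by (auto simp: fun_eq_iff intro!: past)
    ultimately show ?thesis by (simp add: o_def I_def[abs_def])
  qed
  have "expectation (\<lambda>\<omega>. \<Phi> (\<lambda>l. X l \<omega>) (X k \<omega>)) = expectation (\<lambda>\<omega>. \<Sum>p\<in>P. \<Phi> (\<lambda>l. X l \<omega>) p * I p \<omega>)"
  proof (rule Bochner_Integration.integral_cong)
    fix \<omega> assume "\<omega> \<in> space M"
    then have "X k \<omega> \<in> P" using measurable_space[OF X] by fastforce
    moreover have "\<Phi> (\<lambda>l. X l \<omega>) p * I p \<omega> = (if X k \<omega> = p then \<Phi> (\<lambda>l. X l \<omega>) p else 0)" for p
      by (simp add: I_def indicator_def)
    ultimately show "\<Phi> (\<lambda>l. X l \<omega>) (X k \<omega>) = (\<Sum>p\<in>P. \<Phi> (\<lambda>l. X l \<omega>) p * I p \<omega>)"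
      using \<open>finite P\<close> by simp
  qed simp
  also have "\<dots> = (\<Sum>p\<in>P. expectation (\<lambda>\<omega>. \<Phi> (\<lambda>l. X l \<omega>) p * I p \<omega>))"
    by (intro Bochner_Integration.integral_sum indep_var_integrable ind int int_I)
  also have "\<dots> = (\<Sum>p\<in>P. expectation (\<lambda>\<omega>. \<Phi> (\<lambda>l. X l \<omega>) p) / real (card P))"
    by (intro sum.cong refl) (simp add: indep_var_lebesgue_integral[OF ind int int_I] E_I)
  also have "\<dots> = expectation (\<lambda>\<omega>. (\<Sum>p\<in>P. \<Phi> (\<lambda>l. X l \<omega>) p) / real (card P))"
    by (simp add: sum_divide_distrib[symmetric] Bochner_Integration.integral_sum int)
  finally show ?thesis .
qed

end

section \<open>Expected error under random reshuffling\<close>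

context dfinito_contraction
begin

context
  fixes M :: "'w measure" and \<tau> :: "nat \<Rightarrow> 'w \<Rightarrow> nat \<Rightarrow> nat"
  assumes rr: "random_reshuffling M n \<tau>"
begin

interpretation prob_space M
  using rr by (simp add: random_reshuffling_def)

lemma reshuffling_measurable: "\<tau> l \<in> measurable M (count_space {p. p permutes {1..n}})"
  using rr by (auto simp: random_reshuffling_def indep_vars_def)

lemma consistent_run_reshuffling:
  assumes "\<omega> \<in> space M"
  shows "consistent (run (\<lambda>l. \<tau> l \<omega>) k)"
  using measurable_space[OF reshuffling_measurable assms] by (intro consistent_run) simp

lemma integrable_run_reshuffling:
  fixes h :: "(nat \<Rightarrow> 'a) \<times> 'a \<Rightarrow> real"
  shows "integrable M (\<lambda>\<omega>. h (run (\<lambda>l. \<tau> l \<omega>) k))"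
  by (rule integrable_finite_past[OF reshuffling_measurable finite_permutations, of k "\<lambda>\<sigma>. h (run \<sigma> k)"])
    (auto cong: run_cong)

text \<open>For a fixed past the fresh order is uniform, so its expectation is the permutation
  average, which contracts the total error by
  \<open>1 - \<theta> + \<theta> * \<rho>\<close>.\<close>

lemma expectation_err_run_reshuffling:
  "expectation (\<lambda>\<omega>. \<Sum>i=1..n. err (run (\<lambda>l. \<tau> l \<omega>) k) i)
    \<le> (1 - \<theta> + \<theta> * \<rho>) ^ k * (\<Sum>i=1..n. (norm (z0 i - zstar i))\<^sup>2)"
proof (induction k)
  case 0
  show ?case by (simp add: err_def prob_space)
next
  case (Suc k)
  define P where "P = {p. p permutes {1..n}}"
  have "finite P" by (simp add: P_def finite_permutations)
  have N: "real (card P) > 0" by (simp add: P_def card_permutations)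
  define W where "W s = (\<Sum>i=1..n. err s i)" for s
  define \<Phi> where "\<Phi> \<sigma> p = W (next_state p (run \<sigma> k))" for \<sigma> p
  have past: "\<Phi> \<sigma> p = \<Phi> \<sigma>' p" if "\<And>l. l < k \<Longrightarrow> \<sigma> l = \<sigma>' l" for \<sigma> \<sigma>' p
    unfolding \<Phi>_def using run_cong[OF that] by (rule arg_cong)
  have "expectation (\<lambda>\<omega>. W (run (\<lambda>l. \<tau> l \<omega>) (Suc k))) = expectation (\<lambda>\<omega>. \<Phi> (\<lambda>l. \<tau> l \<omega>) (\<tau> k \<omega>))"
    unfolding \<Phi>_def run_Suc ..
  also have "\<dots> = expectation (\<lambda>\<omega>. (\<Sum>p\<in>P. \<Phi> (\<lambda>l. \<tau> l \<omega>) p) / real (card P))"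
    using rr by (intro expectation_indep_uniform_next \<open>finite P\<close> past)
      (auto simp: random_reshuffling_def P_def)
  also have "\<dots> \<le> expectation (\<lambda>\<omega>. (1 - \<theta> + \<theta> * \<rho>) * W (run (\<lambda>l. \<tau> l \<omega>) k))"
  proof (rule integral_mono)
    show "integrable M (\<lambda>\<omega>. (\<Sum>p\<in>P. \<Phi> (\<lambda>l. \<tau> l \<omega>) p) / real (card P))"
      unfolding \<Phi>_def by (rule integrable_run_reshuffling)
    show "integrable M (\<lambda>\<omega>. (1 - \<theta> + \<theta> * \<rho>) * W (run (\<lambda>l. \<tau> l \<omega>) k))"
      by (rule integrable_run_reshuffling)
    show "(\<Sum>p\<in>P. \<Phi> (\<lambda>l. \<tau> l \<omega>) p) / real (card P) \<le> (1 - \<theta> + \<theta> * \<rho>) * W (run (\<lambda>l. \<tau> l \<omega>) k)"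
      if "\<omega> \<in> space M" for \<omega>
      using sum_permutations_err_next_state[OF consistent_run_reshuffling[OF that, of k]] N
      by (simp add: \<Phi>_def W_def P_def divide_le_eq mult.commute)
  qed
  also have "\<dots> = (1 - \<theta> + \<theta> * \<rho>) * expectation (\<lambda>\<omega>. W (run (\<lambda>l. \<tau> l \<omega>) k))"
    by simp
  also have "\<dots> \<le> (1 - \<theta> + \<theta> * \<rho>) * ((1 - \<theta> + \<theta> * \<rho>) ^ k * (\<Sum>i=1..n. (norm (z0 i - zstar i))\<^sup>2))"
    using theta rho Suc.IH by (intro mult_left_mono) (auto simp: W_def)
  finally show ?case by (simp add: W_def mult.assoc)
qed

end

end

section \<open>The two rates for the composite problem\<close>

theorem theorem3:
  fixes f :: "nat \<Rightarrow> real ^ 'd \<Rightarrow> real"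
    and r :: "real ^ 'd \<Rightarrow> ereal"
    and n :: nat
    and \<mu> L \<alpha> \<theta> :: real
    and z0 zstar :: "nat \<Rightarrow> real ^ 'd"
    and xstar :: "real ^ 'd"
  assumes n: "n \<ge> 1"
    and mu_L: "0 < \<mu>" "\<mu> \<le> L"
    and f_strongly_convex: "\<And>i. i \<in> {1..n} \<Longrightarrow> strongly_convex \<mu> (f i)"
    and f_smooth: "\<And>i. i \<in> {1..n} \<Longrightarrow> smooth_fun L (f i)"
    and r: "ereal_convex r" "ereal_closed r" "ereal_proper r"
    and alpha: "0 < \<alpha>" "\<alpha> \<le> 2 / (\<mu> + L)"
    and theta: "0 < \<theta>" "\<theta> < 1"
    and xstar: "is_arg_min (\<lambda>x. ereal ((\<Sum>i=1..n. f i x) / real n) + r x) (\<lambda>_. True) xstar"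
    and zstar: "\<And>i. i \<in> {1..n} \<Longrightarrow> zstar i = xstar - \<alpha> *\<^sub>R grad (f i) xstar"
  shows
    "(\<forall>\<pi> k. \<pi> permutes {1..n} \<longrightarrow>
        (norm (dfinito_iterate n \<alpha> \<theta> f r z0 (epoch_index n (\<lambda>_. \<pi>)) (k * n) - xstar))\<^sup>2
          \<le> (1 - 2 * \<theta> * \<alpha> * \<mu> * L / (\<mu> + L)) ^ k * ((ln (real n) + 1) / real n)
             * (order_norm n \<pi> (\<lambda>i. z0 i - zstar i))\<^sup>2)
     \<and>
     (\<forall>(M :: 'w measure) \<tau> k. random_reshuffling M n \<tau> \<longrightarrow>
        integrable M (\<lambda>\<omega>. (norm (dfinito_iterate n \<alpha> \<theta> f r z0
            (epoch_index n (\<lambda>l. \<tau> l \<omega>)) (k * n) - xstar))\<^sup>2) \<and>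
        prob_space.expectation M (\<lambda>\<omega>. (norm (dfinito_iterate n \<alpha> \<theta> f r z0
            (epoch_index n (\<lambda>l. \<tau> l \<omega>)) (k * n) - xstar))\<^sup>2)
          \<le> (1 - 2 * \<theta> * \<alpha> * \<mu> * L / (\<mu> + L)) ^ k * (1 / real n)
             * (stacked_norm n (\<lambda>i. z0 i - zstar i))\<^sup>2)"
proof -
  define \<rho> where "\<rho> = 1 - 2 * \<alpha> * \<mu> * L / (\<mu> + L)"
  have pos: "0 < L" "0 < \<mu> + L" using mu_L by auto
  \<comment> \<open>With the step-size bound this gives \<open>\<rho> \<ge> 0\<close>, as the locale
    demands.\<close>
  have four_le: "4 * (\<mu> * L) \<le> (\<mu> + L)\<^sup>2"
    using zero_le_power2[of "\<mu> - L"] by (simp add: power2_eq_square algebra_simps)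
  have "2 * \<alpha> * \<mu> * L / (\<mu> + L) \<le> 2 * (2 / (\<mu> + L)) * \<mu> * L / (\<mu> + L)"
    using alpha mu_L pos by (intro divide_right_mono mult_right_mono mult_left_mono) auto
  also have "\<dots> = 4 * (\<mu> * L) / (\<mu> + L)\<^sup>2"
    by (simp add: power2_eq_square)
  also have "\<dots> \<le> 1"
    using pos four_le by simp
  finally have rho: "0 \<le> \<rho>" "\<rho> \<le> 1"
    using alpha mu_L pos by (auto simp: \<rho>_def)
  define G where "G = (\<Sum>i=1..n. grad (f i) xstar) /\<^sub>R real n"
  have G: "GDERIV (\<lambda>x. (\<Sum>i=1..n. f i x) / real n) xstar :> G"
  proof -
    have "(f i has_derivative (\<lambda>h. inner h (grad (f i) xstar))) (at xstar)" if "i \<in> {1..n}" for i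
      using GDERIV_grad[of "f i" xstar] f_smooth[OF that] by (simp add: smooth_fun_def gderiv_def)
    then have "((\<lambda>x. (\<Sum>i=1..n. f i x) * inverse (real n)) has_derivative
        (\<lambda>h. (\<Sum>i=1..n. inner h (grad (f i) xstar)) * inverse (real n))) (at xstar)"
      by (intro has_derivative_mult_left has_derivative_sum) auto
    then show ?thesis
      by (simp add: gderiv_def G_def inner_sum_right divide_inverse mult.commute)
  qed
  \<comment> \<open>The mean of \<open>zstar\<close> is the forward gradient step from
    \<open>xstar\<close>, the point in the nonexpansiveness bound for \<open>prox\<close>.\<close>
  have mean_zstar: "(\<Sum>i=1..n. zstar i) /\<^sub>R real n = xstar - \<alpha> *\<^sub>R G"
  proof -
    have "(\<Sum>i=1..n. zstar i) = real n *\<^sub>R xstar - \<alpha> *\<^sub>R (\<Sum>i=1..n. grad (f i) xstar)"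
      by (simp add: zstar sum_subtractf scaleR_sum_right sum_constant_scaleR del: sum_constant)
    then show ?thesis using n by (simp add: G_def scaleR_diff_right)
  qed
  interpret dfinito_contraction n \<alpha> \<theta> \<rho> f r z0 xstar zstar
  proof
    show "norm (prox \<alpha> r x - xstar) \<le> norm (x - (\<Sum>i=1..n. zstar i) /\<^sub>R real n)" for x
      unfolding mean_zstar by (rule prox_dist_minimizer[OF r alpha(1) xstar G])
    show "(norm (x - \<alpha> *\<^sub>R grad (f i) x - zstar i))\<^sup>2 \<le> \<rho> * (norm (x - xstar))\<^sup>2"
      if "i \<in> {1..n}" for i x
      unfolding \<rho>_def zstar[OF that] using alpha
      by (intro gradient_step_contraction f_strongly_convex[OF that] f_smooth[OF that] mu_L) auto
  qed (use n theta rho in auto)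
  have rate: "1 - 2 * \<theta> * \<alpha> * \<mu> * L / (\<mu> + L) = 1 - \<theta> + \<theta> * \<rho>"
    by (simp add: \<rho>_def right_diff_distrib)
  show ?thesis
    unfolding rate dfinito_iterate_def
  proof (intro conjI allI impI)
    fix \<pi> k assume \<pi>: "\<pi> permutes {1..n}"
    have "(norm (prox \<alpha> r (snd (run (\<lambda>_. \<pi>) k)) - xstar))\<^sup>2
        \<le> (ln (real n) + 1) / real n * (\<Sum>i=1..n. real i / real n * err (run (\<lambda>_. \<pi>) k) (\<pi> i))"
      by (intro prox_dist_le_weighted consistent_run \<pi>)
    also have "\<dots> \<le> (ln (real n) + 1) / real n * ((1 - \<theta> + \<theta> * \<rho>) ^ k *
        (\<Sum>i=1..n. real i / real n * (norm (z0 (\<pi> i) - zstar (\<pi> i)))\<^sup>2))"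
      using n by (intro mult_left_mono weighted_err_run \<pi>) (auto intro!: divide_nonneg_nonneg add_nonneg_nonneg)
    also have "(\<Sum>i=1..n. real i / real n * (norm (z0 (\<pi> i) - zstar (\<pi> i)))\<^sup>2)
        = (order_norm n \<pi> (\<lambda>i. z0 i - zstar i))\<^sup>2"
      unfolding order_norm_def by (subst real_sqrt_pow2) (auto intro: sum_nonneg)
    finally show "(norm (prox \<alpha> r (snd (run (\<lambda>_. \<pi>) k)) - xstar))\<^sup>2
        \<le> (1 - \<theta> + \<theta> * \<rho>) ^ k * ((ln (real n) + 1) / real n) * (order_norm n \<pi> (\<lambda>i. z0 i - zstar i))\<^sup>2"
      by (simp only: mult_ac)
  next
    fix M :: "'w measure" and \<tau> k assume rr: "random_reshuffling M n \<tau>"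
    show int: "integrable M (\<lambda>\<omega>. (norm (prox \<alpha> r (snd (run (\<lambda>l. \<tau> l \<omega>) k)) - xstar))\<^sup>2)"
      by (rule integrable_run_reshuffling[OF rr])
    \<comment> \<open>Here the unweighted mean of the errors contracts, so the plain bound on the
      iterate applies and no logarithm arises.\<close>
    have "integral\<^sup>L M (\<lambda>\<omega>. (norm (prox \<alpha> r (snd (run (\<lambda>l. \<tau> l \<omega>) k)) - xstar))\<^sup>2)
        \<le> integral\<^sup>L M (\<lambda>\<omega>. (\<Sum>i=1..n. err (run (\<lambda>l. \<tau> l \<omega>) k) i) / real n)"
      by (intro integral_mono int integrable_run_reshuffling[OF rr] prox_dist_le_average
          consistent_run_reshuffling[OF rr])
    also have "\<dots> \<le> ((1 - \<theta> + \<theta> * \<rho>) ^ k * (\<Sum>i=1..n. (norm (z0 i - zstar i))\<^sup>2)) / real n"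
      using expectation_err_run_reshuffling[OF rr, of k] by (simp add: divide_right_mono)
    also have "(\<Sum>i=1..n. (norm (z0 i - zstar i))\<^sup>2) = (stacked_norm n (\<lambda>i. z0 i - zstar i))\<^sup>2"
      unfolding stacked_norm_def L2_set_def by (subst real_sqrt_pow2) (auto intro: sum_nonneg)
    finally show "integral\<^sup>L M (\<lambda>\<omega>. (norm (prox \<alpha> r (snd (run (\<lambda>l. \<tau> l \<omega>) k)) - xstar))\<^sup>2)
        \<le> (1 - \<theta> + \<theta> * \<rho>) ^ k * (1 / real n) * (stacked_norm n (\<lambda>i. z0 i - zstar i))\<^sup>2"
      by simp
  qed
qed

end
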